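(* Let $G$ be a graph, let $e\notin E(G)$ be a pair of distinct non-adjacent vertices of $G$, and let $G' = G+e$ be the graph obtained from $G$ by adding the edge $e$. Then $\mathrm{USN}(G')\ge \mathrm{USN}(G)-1$.
   Context: Graphs are finite, simple and undirected. A valid labelling of a graph $G$ with universe a finite set $S$ assigns to the vertices of $G$ pairwise distinct nonempty subsets of $S$ such that two distinct vertices are adjacent if and only if their labels are disjoint. The universe size number $\mathrm{USN}(G)$ is the minimum of $|S|$ over all finite sets $S$ for which $G$ has a valid labelling with universe $S$. *)

theory Defs
  imports Main
begin

record 'a ugraph =
  verts :: "'a set"
  edges :: "'a set set"

definition simple_graph :: "'a ugraph \<Rightarrow> bool" where
  "simple_graph G \<longleftrightarrow> finite (verts G) \<and> (\<forall>e \<in> edges G. e \<subseteq> verts G \<and> card e = 2)"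

definition adjacent :: "'a ugraph \<Rightarrow> 'a \<Rightarrow> 'a \<Rightarrow> bool" where
  "adjacent G u v \<longleftrightarrow> {u, v} \<in> edges G"

definition add_edge :: "'a ugraph \<Rightarrow> 'a \<Rightarrow> 'a \<Rightarrow> 'a ugraph" where
  "add_edge G u v = G\<lparr>edges := insert {u, v} (edges G)\<rparr>"

definition valid_labelling :: "'a ugraph \<Rightarrow> 'b set \<Rightarrow> ('a \<Rightarrow> 'b set) \<Rightarrow> bool" where
  "valid_labelling G S L \<longleftrightarrow>
     (\<forall>v \<in> verts G. L v \<subseteq> S \<and> L v \<noteq> {}) \<and>
     inj_on L (verts G) \<and>
     (\<forall>u \<in> verts G. \<forall>v \<in> verts G. u \<noteq> v \<longrightarrow> (adjacent G u v \<longleftrightarrow> L u \<inter> L v = {}))"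

(* The universes are taken to be finite sets of natural numbers. This loses no generality:
   USN_le below bounds USN by the size of a universe of any element type, and
   USN_attained shows that the minimum is over a nonempty set. *)
definition USN :: "'a ugraph \<Rightarrow> nat" where
  "USN G = (LEAST n. \<exists>(S :: nat set) L. finite S \<and> card S = n \<and> valid_labelling G S L)"

lemma valid_labelling_image:
  assumes "valid_labelling G S L" and "inj_on f S"
  shows "valid_labelling G (f ` S) (\<lambda>v. f ` L v)"
proof -
  have sub: "L v \<subseteq> S" if "v \<in> verts G" for v
    using assms(1) that by (auto simp: valid_labelling_def)
  have disj: "f ` L u \<inter> f ` L v = {} \<longleftrightarrow> L u \<inter> L v = {}"
    if "u \<in> verts G" "v \<in> verts G" for u v
    using inj_on_image_Int[OF assms(2) sub[OF that(1)] sub[OF that(2)]] by auto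
  have "inj_on (\<lambda>v. f ` L v) (verts G)"
    using assms sub unfolding valid_labelling_def inj_on_def[of _ "verts G"]
    by (metis inj_on_image_eq_iff)
  then show ?thesis
    using assms(1) disj sub by (simp add: valid_labelling_def image_mono)
qed

lemma USN_le:
  fixes S :: "'b set"
  assumes "finite S" and "valid_labelling G S L"
  shows "USN G \<le> card S"
proof -
  obtain f :: "'b \<Rightarrow> nat" where f: "inj_on f S"
    using finite_imp_inj_to_nat_seg[OF assms(1)] by blast
  have "finite (f ` S) \<and> card (f ` S) = card S \<and> valid_labelling G (f ` S) (\<lambda>v. f ` L v)"
    using assms f by (simp add: card_image valid_labelling_image)
  then show ?thesis
    unfolding USN_def by (intro Least_le) blast
qed

lemma valid_labelling_exists:
  fixes G :: "'a ugraph"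
  assumes "simple_graph G"
  shows "\<exists>(S :: 'a set set) L. finite S \<and> valid_labelling G S L"
proof -
  define L where "L v = insert {v} {{v, w} | w. w \<in> verts G \<and> w \<noteq> v \<and> \<not> adjacent G v w}" for v
  have L_iff: "s \<in> L v \<longleftrightarrow> s = {v} \<or> (\<exists>w \<in> verts G. w \<noteq> v \<and> \<not> adjacent G v w \<and> s = {v, w})" for s v
    unfolding L_def by blast
  have singleton: "{x} \<in> L y \<longleftrightarrow> x = y" for x y
    unfolding L_iff by auto
  have sub: "L v \<subseteq> Pow (verts G)" if "v \<in> verts G" for v
    using that unfolding L_def by blast
  have "inj_on L (verts G)"
    using singleton by (metis inj_onI)
  moreover have "adjacent G u v \<longleftrightarrow> L u \<inter> L v = {}"
    if uv: "u \<in> verts G" "v \<in> verts G" "u \<noteq> v" for u v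
  proof -
    have "\<not> adjacent G u v" if "s \<in> L u" "s \<in> L v" for s
    proof -
      have "u \<in> s" "v \<in> s"
        using that unfolding L_iff by blast+
      then show ?thesis
        using \<open>s \<in> L u\<close> uv(3) unfolding L_iff by blast
    qed
    moreover have "{u, v} \<in> L u \<inter> L v" if "\<not> adjacent G u v"
    proof
      have "\<not> adjacent G v u"
        using that unfolding adjacent_def by (subst insert_commute)
      then show "{u, v} \<in> L v"
        using uv unfolding L_iff by (metis insert_commute)
      show "{u, v} \<in> L u"
        using uv that unfolding L_iff by metis
    qed
    ultimately show ?thesis
      by blast
  qed
  ultimately have "valid_labelling G (Pow (verts G)) L"
    using sub singleton unfolding valid_labelling_def by (metis empty_iff)
  moreover have "finite (Pow (verts G))"
    using assms by (simp add: simple_graph_def)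
  ultimately show ?thesis
    by blast
qed

lemma USN_attained:
  fixes G :: "'a ugraph"
  assumes "simple_graph G"
  shows "\<exists>(S :: nat set) L. finite S \<and> card S = USN G \<and> valid_labelling G S L"
proof -
  obtain S :: "'a set set" and L where S: "finite S" "valid_labelling G S L"
    using valid_labelling_exists[OF assms] by blast
  obtain f :: "'a set \<Rightarrow> nat" where f: "inj_on f S"
    using finite_imp_inj_to_nat_seg[OF S(1)] by blast
  have "\<exists>n (S :: nat set) L. finite S \<and> card S = n \<and> valid_labelling G S L"
    using finite_imageI[OF S(1)] valid_labelling_image[OF S(2) f] by metis
  then show ?thesis
    unfolding USN_def by (rule LeastI_ex)
qed

end

theory Submission
  imports Defs
begin

(* The labels of u and v are disjoint in a labelling of G + e; inserting one fresh element
   into both makes them meet and changes no other intersection, so it labels G. *)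

text \<open>Take an optimal labelling of G + e, available from \<open>USN_attained\<close> since G +
  e is again simple. \<open>valid_labelling_remove_edge\<close> converts it into a labelling of G at
  the cost of a single new universe element, so \<open>USN_le\<close> gives USN(G) \<le> USN(G + e)
  + 1.\<close>

lemma simple_graph_add_edge:
  assumes "simple_graph G" and "u \<in> verts G" and "v \<in> verts G" and "u \<noteq> v"
  shows "simple_graph (add_edge G u v)"
  using assms by (auto simp: simple_graph_def add_edge_def)

lemma adjacent_add_edge:
  "adjacent (add_edge G u v) a b \<longleftrightarrow> {a, b} = {u, v} \<or> adjacent G a b"
  by (auto simp: adjacent_def add_edge_def)

lemma valid_labelling_remove_edge:
  assumes val: "valid_labelling (add_edge G u v) S L"
    and "\<not> adjacent G u v" and x: "x \<notin> S"
  shows "valid_labelling G (insert x S) (\<lambda>w. if w = u \<or> w = v then insert x (L w) else L w)"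
    (is "valid_labelling G _ ?L")
proof -
  have verts: "verts (add_edge G u v) = verts G"
    by (simp add: add_edge_def)
  have lab: "L w \<subseteq> S" "L w \<noteq> {}" "x \<notin> L w" if "w \<in> verts G" for w
    using val x that by (auto simp: valid_labelling_def verts)
  \<comment> \<open>Deleting \<open>x\<close> recovers the old labels, so distinct vertices cannot
    acquire equal labels under \<open>?L\<close>.\<close>
  have restrict: "?L w - {x} = L w" if "w \<in> verts G" for w
    using lab(3)[OF that] by auto
  have "inj_on ?L (verts G)"
  proof (rule inj_onI)
    fix a b
    assume ab: "a \<in> verts G" "b \<in> verts G" and eq: "?L a = ?L b"
    have "?L a - {x} = ?L b - {x}"
      by (simp only: eq)
    then have "L a = L b"
      by (simp only: restrict[OF ab(1)] restrict[OF ab(2)])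
    then show "a = b"
      using val ab unfolding valid_labelling_def verts by (blast dest: inj_onD)
  qed
  moreover have "adjacent G a b \<longleftrightarrow> ?L a \<inter> ?L b = {}"
    if ab: "a \<in> verts G" "b \<in> verts G" "a \<noteq> b" for a b
  proof (cases "{a, b} = {u, v}")
    case True
    then have "\<not> adjacent G a b"
      using assms(2) by (simp add: adjacent_def)
    moreover have "x \<in> ?L a \<inter> ?L b"
      using True by (auto simp: doubleton_eq_iff)
    ultimately show ?thesis
      by blast
  next
    case False
    then have "adjacent G a b \<longleftrightarrow> L a \<inter> L b = {}"
      using val ab unfolding valid_labelling_def verts adjacent_add_edge by blast
    \<comment> \<open>As \<open>a\<close> and \<open>b\<close> are distinct and do not form the pair
      \<open>{u, v}\<close>, at most one of them receives \<open>x\<close>, and \<open>x\<close>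
      lies in no old label.\<close>
    moreover have "?L a \<inter> ?L b = L a \<inter> L b"
      using False ab lab(3) by auto
    ultimately show ?thesis
      by simp
  qed
  moreover have "?L w \<subseteq> insert x S \<and> ?L w \<noteq> {}" if "w \<in> verts G" for w
    using lab[OF that] by auto
  ultimately show ?thesis
    unfolding valid_labelling_def by blast
qed

theorem theorem19:
  fixes G :: "'a ugraph" and u v :: 'a
  assumes "simple_graph G"
    and "u \<in> verts G" and "v \<in> verts G" and "u \<noteq> v" and "\<not> adjacent G u v"
  shows "int (USN (add_edge G u v)) \<ge> int (USN G) - 1"
proof -
  obtain S :: "nat set" and L where S: "finite S" "card S = USN (add_edge G u v)"
      "valid_labelling (add_edge G u v) S L"
    using USN_attained[OF simple_graph_add_edge[OF assms(1-4)]] by blast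
  \<comment> \<open>A fresh element exists because \<open>S\<close> is a finite set of naturals; it
    raises the cardinality by exactly one.\<close>
  obtain x where x: "x \<notin> S"
    using ex_new_if_finite[OF infinite_UNIV_nat S(1)] by blast
  have "USN G \<le> card (insert x S)"
    using S(1) valid_labelling_remove_edge[OF S(3) assms(5) x] by (intro USN_le) auto
  then show ?thesis
    using S x by simp
qed

end
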